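(* Let $X$ and $Y$ be finite sets and let $f : X \times Y \to \{\pm 1\}$ be a function whose matrix $M \in \{\pm 1\}^{X \times Y}$, $M_{xy} = f(x,y)$, has rank $r$ over $\mathbb{R}$. Let $\mu$ be a probability measure on $X \times Y$ with $\mu(f^{-1}(1)) \geq \delta > 0$. Then there exists a rectangle $R = X' \times Y'$ with $X' \subseteq X$, $Y' \subseteq Y$, such that $\mu(R) \geq 2^{-\Theta(\sqrt{r} \log \frac{1}{\delta})}$ and $\mathbb{E}_{(x,y) \sim R}[f(x,y)] \geq 1 - \delta$, where $(x,y) \sim R$ denotes a pair drawn from $R$ according to $\mu$ conditioned on $R$.
   Context: A rectangle in $X \times Y$ is a set of the form $X' \times Y'$ with $X' \subseteq X$ and $Y' \subseteq Y$. The notation $\Theta(\cdot)$ in the exponent hides absolute constants independent of $f$, $\mu$, $r$ and $\delta$. *)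

theory Defs
  imports "HOL-Probability.Probability" "HOL-Library.Function_Algebras"
begin

(* The library states no real_vector instance for function types, so the real vector space of
   functions is given by its scaling operation. *)
lemma vector_space_fun: "vector_space (\<lambda>(c::real) (g::'a \<Rightarrow> real) x. c * g x)"
  by unfold_locales (auto simp: fun_eq_iff algebra_simps)

(* Dimension of the column space: each column is an element of R^X, represented as a function
   vanishing outside X. *)
definition matrix_rank :: "'a set \<Rightarrow> 'b set \<Rightarrow> ('a \<Rightarrow> 'b \<Rightarrow> real) \<Rightarrow> nat" where
  "matrix_rank X Y M =
     vector_space.dim (\<lambda>(c::real) (g::'a \<Rightarrow> real) x. c * g x)
       ((\<lambda>y x. if x \<in> X then M x y else 0) ` Y)"

(* The two type arguments record the types in which the finite sets X and Y live.
   A draw from a rectangle R according to \<mu> conditioned on R is cond_pmf \<mu> R; it is meaningful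
   because the lower bound on the mass of R is positive. *)
definition rectangle_bound :: "'a itself \<Rightarrow> 'b itself \<Rightarrow> real \<Rightarrow> bool" where
  "rectangle_bound TA TB C \<longleftrightarrow>
     (\<forall>(X::'a set) (Y::'b set) (f::'a \<times> 'b \<Rightarrow> real) (r::nat) (\<mu>::('a \<times> 'b) pmf) (\<delta>::real).
        finite X \<longrightarrow> finite Y \<longrightarrow>
        f \<in> X \<times> Y \<rightarrow> {-1, 1} \<longrightarrow>
        matrix_rank X Y (\<lambda>x y. f (x, y)) = r \<longrightarrow>
        set_pmf \<mu> \<subseteq> X \<times> Y \<longrightarrow>
        \<delta> > 0 \<longrightarrow>
        measure_pmf.prob \<mu> {z \<in> X \<times> Y. f z = 1} \<ge> \<delta> \<longrightarrow>
        (\<exists>X' Y'. X' \<subseteq> X \<and> Y' \<subseteq> Y \<and>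
           measure_pmf.prob \<mu> (X' \<times> Y') \<ge> 2 powr (- (C * (sqrt (real r) * log 2 (1 / \<delta>)))) \<and>
           measure_pmf.expectation (cond_pmf \<mu> (X' \<times> Y')) f \<ge> 1 - \<delta>))"

end

theory Submission
  imports Defs
begin

text \<open>
  Let \<open>M\<close> have rank \<open>r\<close> and let \<open>V\<close> be its column space. There is a weight \<open>w\<close> on \<open>X\<close> of total mass at
  most 1 such that \<open>g(x)\<^sup>2 \<le> 2 r \<parallel>g\<parallel>\<^sup>2\<close> for all \<open>g \<in> V\<close> and \<open>x \<in> X\<close>, with the norm of \<open>L\<^sup>2(w)\<close>; this is
  John's theorem up to the factor 2. Coordinates in an orthonormal basis of \<open>V\<close> then give
  \<open>M\<^sub>x\<^sub>y = \<langle>u\<^sub>x, v\<^sub>y\<rangle>\<close> with \<open>\<parallel>u\<^sub>x\<parallel>\<^sup>2 \<le> 2 r\<close> and \<open>\<parallel>v\<^sub>y\<parallel> \<le> 1\<close>, since columns of signs have norm at most 1.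

  To find \<open>w\<close>, start from the uniform weight and repeatedly multiply it by \<open>h / r\<close>, where \<open>h(x)\<close> is the
  leverage score of \<open>x\<close>. Products of successive scores telescope, so by the inequality of arithmetic
  and geometric means the average of the first \<open>|X|\<close> weights is good.

  For a Gaussian vector \<open>g\<close>, the expectation of \<open>sin \<langle>g, u\<rangle> sin \<langle>g, v\<rangle>\<close> is
  \<open>exp (-(\<parallel>u\<parallel>\<^sup>2 + \<parallel>v\<parallel>\<^sup>2) / 2) sinh \<langle>u, v\<rangle>\<close>. Applied to the rescaled factorization, this yields bounded random
  variables whose correlation has the sign of \<open>M\<^sub>x\<^sub>y\<close> and size at least of order \<open>1 / \<surd>r\<close>. Rounding them gives,
  for any weight, a rectangle that favours the entries 1 over the entries -1 by a factor
  \<open>1 + \<Omega>(1 / \<surd>r)\<close>. Intersecting \<open>O(\<surd>r log (1 / \<delta>))\<close> such rectangles, each chosen for the weight that the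
  remaining steps will see, makes the share of the entries -1 at most \<open>\<delta> / 2\<close>. For \<open>\<delta> \<ge> 2/3\<close> the rectangle
  \<open>X \<times> Y\<close> already works.
\<close>

section \<open>Orthonormal families and leverage scores\<close>

global_interpretation fun_vs: vector_space "\<lambda>(c::real) (g::'a \<Rightarrow> real) x. c * g x"
  by (rule vector_space_fun)

definition weighted_ip :: "'a set \<Rightarrow> ('a \<Rightarrow> real) \<Rightarrow> ('a \<Rightarrow> real) \<Rightarrow> ('a \<Rightarrow> real) \<Rightarrow> real" where
  "weighted_ip X w g h = (\<Sum>x\<in>X. w x * g x * h x)"

definition orthonormal_family :: "'a set \<Rightarrow> ('a \<Rightarrow> real) \<Rightarrow> ('a \<Rightarrow> real) set \<Rightarrow> bool" where
  "orthonormal_family X w B \<longleftrightarrow>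
     (\<forall>b\<in>B. \<forall>c\<in>B. weighted_ip X w b c = (if b = c then 1 else 0))"

lemma weighted_ip_commute: "weighted_ip X w g h = weighted_ip X w h g"
  unfolding weighted_ip_def by (rule sum.cong) auto

lemma weighted_ip_cong:
  assumes "\<And>x. x \<in> X \<Longrightarrow> g x = g' x" "\<And>x. x \<in> X \<Longrightarrow> h x = h' x"
  shows "weighted_ip X w g h = weighted_ip X w g' h'"
  unfolding weighted_ip_def using assms by (intro sum.cong) auto

lemma weighted_ip_add_left:
  "weighted_ip X w (\<lambda>x. c * g x + k x) h = c * weighted_ip X w g h + weighted_ip X w k h"
  unfolding weighted_ip_def by (simp add: sum_distrib_left sum.distrib algebra_simps)

lemma weighted_ip_sum_left:
  "weighted_ip X w (\<lambda>x. \<Sum>b\<in>B. c b * G b x) h = (\<Sum>b\<in>B. c b * weighted_ip X w (G b) h)"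
proof -
  have "weighted_ip X w (\<lambda>x. \<Sum>b\<in>B. c b * G b x) h = (\<Sum>x\<in>X. \<Sum>b\<in>B. c b * (w x * G b x * h x))"
    unfolding weighted_ip_def
    by (simp add: sum_distrib_left sum_distrib_right algebra_simps)
  also have "\<dots> = (\<Sum>b\<in>B. \<Sum>x\<in>X. c b * (w x * G b x * h x))"
    by (rule sum.swap)
  finally show ?thesis
    unfolding weighted_ip_def by (simp add: sum_distrib_left)
qed

lemma weighted_ip_self_eq_0D:
  assumes "finite X" "\<And>x. x \<in> X \<Longrightarrow> w x > 0" "weighted_ip X w g g = 0" "x \<in> X"
  shows "g x = 0"
proof -
  have "\<forall>x\<in>X. w x * g x * g x = 0"
    using assms(3) unfolding weighted_ip_def
    by (subst (asm) sum_nonneg_eq_0_iff)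
       (use assms(1,2) in \<open>auto simp: mult.assoc less_imp_le\<close>)
  then show ?thesis
    using assms(2,4) by fastforce
qed

lemma weighted_ip_self_nonneg:
  assumes "\<And>x. x \<in> X \<Longrightarrow> w x \<ge> 0"
  shows "weighted_ip X w g g \<ge> 0"
  unfolding weighted_ip_def using assms by (intro sum_nonneg) (simp add: mult.assoc)

lemma fun_span_sum:
  assumes "finite B" "\<And>b. b \<in> B \<Longrightarrow> G b \<in> fun_vs.span S"
  shows "(\<lambda>x. \<Sum>b\<in>B. c b * G b x) \<in> fun_vs.span S"
proof -
  have "(\<Sum>b\<in>B. (\<lambda>x. c b * G b x)) \<in> fun_vs.span S"
    using assms by (intro fun_vs.span_sum fun_vs.span_scale) auto
  moreover have "(\<Sum>b\<in>B. (\<lambda>x. c b * G b x)) = (\<lambda>x. \<Sum>b\<in>B. c b * G b x)"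
    using assms(1) by (induction B rule: finite_induct) (auto simp: fun_eq_iff)
  ultimately show ?thesis by simp
qed

text \<open>Gram-Schmidt by induction on \<open>S\<close>. The form sees only values on
  \<open>X\<close>, so a residual of norm 0 vanishes on \<open>X\<close> and is dropped, and
  functions of the span are recovered on \<open>X\<close> only.\<close>

lemma orthonormal_family_exists:
  fixes X :: "'a set" and w :: "'a \<Rightarrow> real" and S :: "('a \<Rightarrow> real) set"
  assumes fin: "finite X" and pos: "\<And>x. x \<in> X \<Longrightarrow> w x > 0" and "finite S"
  obtains B where "finite B" "card B \<le> card S" "B \<subseteq> fun_vs.span S" "orthonormal_family X w B"
    "\<forall>g\<in>fun_vs.span S. \<forall>x\<in>X. g x = (\<Sum>b\<in>B. weighted_ip X w g b * b x)"
proof -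
  have "\<exists>B. finite B \<and> card B \<le> card S \<and> B \<subseteq> fun_vs.span S \<and> orthonormal_family X w B \<and>
    (\<forall>g\<in>S. \<forall>x\<in>X. g x = (\<Sum>b\<in>B. weighted_ip X w g b * b x))"
    using \<open>finite S\<close>
  proof (induction S rule: finite_induct)
    case empty
    then show ?case by (intro exI[of _ "{}"]) (auto simp: orthonormal_family_def)
  next
    case (insert s S)
    then obtain B where B: "finite B" "card B \<le> card S" "B \<subseteq> fun_vs.span S"
        "orthonormal_family X w B"
      and rep: "\<forall>g\<in>S. \<forall>x\<in>X. g x = (\<Sum>b\<in>B. weighted_ip X w g b * b x)"
      by blast
    have sub: "fun_vs.span S \<subseteq> fun_vs.span (insert s S)"
      by (rule fun_vs.span_mono) auto
    define p where "p = (\<lambda>x. \<Sum>b\<in>B. weighted_ip X w s b * b x)"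
    define d where "d = (\<lambda>x. s x - p x)"
    define n where "n = weighted_ip X w d d"
    have d_orth: "weighted_ip X w d b = 0" if "b \<in> B" for b
    proof -
      have "weighted_ip X w p b = (\<Sum>c\<in>B. weighted_ip X w s c * weighted_ip X w c b)"
        unfolding p_def by (rule weighted_ip_sum_left)
      also have "\<dots> = (\<Sum>c\<in>B. if c = b then weighted_ip X w s c else 0)"
        using B(4) that by (intro sum.cong) (auto simp: orthonormal_family_def)
      also have "\<dots> = weighted_ip X w s b"
        using B(1) that by simp
      finally have "weighted_ip X w p b = weighted_ip X w s b" .
      moreover have "weighted_ip X w d b = (- 1) * weighted_ip X w p b + weighted_ip X w s b"
        unfolding d_def using weighted_ip_add_left[of X w "-1" p s b] by simp
      ultimately show ?thesis by simp
    qed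
    show ?case
    proof (cases "n = 0")
      case True
      have "s x = p x" if "x \<in> X" for x
        using weighted_ip_self_eq_0D[of X w d x] fin pos True that by (simp add: n_def d_def)
      then have "\<forall>g\<in>insert s S. \<forall>x\<in>X. g x = (\<Sum>b\<in>B. weighted_ip X w g b * b x)"
        using rep by (auto simp: p_def)
      then show ?thesis
        using B sub insert.hyps by (intro exI[of _ B]) auto
    next
      case False
      then have n: "n > 0"
        using weighted_ip_self_nonneg[of X w d] pos unfolding n_def by (force simp: less_le)
      define e where "e = (\<lambda>x. (1 / sqrt n) * d x)"
      have e_ip: "weighted_ip X w e g = (1 / sqrt n) * weighted_ip X w d g" for g
        unfolding e_def using weighted_ip_add_left[of X w "1 / sqrt n" d "\<lambda>_. 0" g]
        by (simp add: weighted_ip_def)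
      have e_orth: "weighted_ip X w e b = 0" if "b \<in> B" for b
        using d_orth[OF that] by (simp add: e_ip)
      then have e_orth': "weighted_ip X w b e = 0" if "b \<in> B" for b
        using that weighted_ip_commute[of X w b e] by simp
      have d_e: "weighted_ip X w d e = sqrt n"
        using n by (subst weighted_ip_commute) (simp add: e_ip n_def[symmetric] real_div_sqrt)
      have e_e: "weighted_ip X w e e = 1"
        using n by (simp add: e_ip[of e] d_e)
      have e_notin: "e \<notin> B"
        using e_orth e_e by force
      have "p \<in> fun_vs.span (insert s S)"
        unfolding p_def using B(1,3) sub by (intro fun_span_sum) auto
      then have "s - p \<in> fun_vs.span (insert s S)"
        by (intro fun_vs.span_diff fun_vs.span_base[of s]) auto
      then have "d \<in> fun_vs.span (insert s S)"
        by (simp add: d_def fun_diff_def)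
      then have e_span: "e \<in> fun_vs.span (insert s S)"
        unfolding e_def by (rule fun_vs.span_scale)
      have on: "orthonormal_family X w (insert e B)"
        using B(4) e_orth e_orth' e_e e_notin
        unfolding orthonormal_family_def by auto
      \<comment> \<open>\<open>s\<close> is \<open>d\<close> plus a combination of \<open>B\<close>,
        to which \<open>e\<close> is orthogonal, so its new coefficient is the norm of
        \<open>d\<close>.\<close>
      have s_e: "weighted_ip X w s e = sqrt n"
      proof -
        have "weighted_ip X w p e = (\<Sum>c\<in>B. weighted_ip X w s c * weighted_ip X w c e)"
          unfolding p_def by (rule weighted_ip_sum_left)
        also have "\<dots> = 0"
          using e_orth' by (intro sum.neutral) auto
        finally have "weighted_ip X w p e = 0" .
        moreover have "weighted_ip X w s e = 1 * weighted_ip X w d e + weighted_ip X w p e"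
          unfolding weighted_ip_add_left[symmetric] by (simp add: d_def)
        ultimately show ?thesis using d_e by simp
      qed
      have S_e: "weighted_ip X w g e = 0" if "g \<in> S" for g
      proof -
        have "weighted_ip X w g e
            = weighted_ip X w (\<lambda>x. \<Sum>b\<in>B. weighted_ip X w g b * b x) e"
          using rep that by (intro weighted_ip_cong) auto
        also have "\<dots> = (\<Sum>b\<in>B. weighted_ip X w g b * weighted_ip X w b e)"
          by (rule weighted_ip_sum_left)
        also have "\<dots> = 0"
          using e_orth' by (intro sum.neutral) auto
        finally show ?thesis .
      qed
      have "g x = (\<Sum>b\<in>insert e B. weighted_ip X w g b * b x)"
        if "g \<in> insert s S" "x \<in> X" for g x
      proof (cases "g \<in> S")
        case True
        then show ?thesis
          using rep that(2) B(1) e_notin S_e by simp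
      next
        case False
        then have "g = s" using that by simp
        moreover have "sqrt n * e x = d x"
          using n by (simp add: e_def)
        ultimately show ?thesis
          using B(1) e_notin s_e by (simp add: d_def p_def)
      qed
      then show ?thesis
        using B sub insert.hyps e_span on e_notin by (intro exI[of _ "insert e B"]) auto
    qed
  qed
  then obtain B where B: "finite B" "card B \<le> card S" "B \<subseteq> fun_vs.span S"
      "orthonormal_family X w B"
    and rep: "\<forall>g\<in>S. \<forall>x\<in>X. g x = (\<Sum>b\<in>B. weighted_ip X w g b * b x)"
    by blast
  \<comment> \<open>The coefficients are linear in \<open>g\<close>, so the expansion passes from
    \<open>S\<close> to its span.\<close>
  have "\<forall>x\<in>X. g x = (\<Sum>b\<in>B. weighted_ip X w g b * b x)" if "g \<in> fun_vs.span S" for g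
    using that
  proof (induction rule: fun_vs.span_induct_alt)
    case base
    then show ?case by (simp add: weighted_ip_def)
  next
    case (step c g h)
    have "weighted_ip X w ((\<lambda>x. c * g x) + h) b
        = c * weighted_ip X w g b + weighted_ip X w h b" for b
      unfolding weighted_ip_add_left[symmetric] by (simp add: plus_fun_def)
    then have sum_eq: "(\<Sum>b\<in>B. weighted_ip X w ((\<lambda>x. c * g x) + h) b * b x)
        = c * (\<Sum>b\<in>B. weighted_ip X w g b * b x) + (\<Sum>b\<in>B. weighted_ip X w h b * b x)" for x
      by (simp only: distrib_right sum.distrib sum_distrib_left mult.assoc)
    show ?case
    proof
      fix x assume "x \<in> X"
      then have "g x = (\<Sum>b\<in>B. weighted_ip X w g b * b x)" "h x = (\<Sum>b\<in>B. weighted_ip X w h b * b x)"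
        using step rep by blast+
      then show "((\<lambda>x. c * g x) + h) x = (\<Sum>b\<in>B. weighted_ip X w ((\<lambda>x. c * g x) + h) b * b x)"
        by (simp only: sum_eq plus_fun_apply)
    qed
  qed
  then show thesis
    by (intro that[OF B]) blast
qed

text \<open>Parseval's identity from the expansion alone: expand the left argument, then use
  linearity and symmetry.\<close>

lemma weighted_ip_self_orthonormal:
  assumes "\<And>x. x \<in> X \<Longrightarrow> g x = (\<Sum>b\<in>B. weighted_ip X w g b * b x)"
  shows "weighted_ip X w g g = (\<Sum>b\<in>B. (weighted_ip X w g b)\<^sup>2)"
proof -
  have "weighted_ip X w g g = weighted_ip X w (\<lambda>x. \<Sum>b\<in>B. weighted_ip X w g b * b x) g"
    using assms by (intro weighted_ip_cong) auto
  also have "\<dots> = (\<Sum>b\<in>B. weighted_ip X w g b * weighted_ip X w b g)"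
    by (rule weighted_ip_sum_left)
  also have "\<dots> = (\<Sum>b\<in>B. (weighted_ip X w g b)\<^sup>2)"
    unfolding power2_eq_square by (intro sum.cong refl arg_cong2[where f = "(*)"] weighted_ip_commute)
  finally show ?thesis .
qed

text \<open>Take for \<open>h\<close> the diagonal of the reproducing kernel of the span. Its
  weighted sum counts an orthonormal basis; the pointwise bound is Cauchy-Schwarz followed by
  Parseval.\<close>

lemma leverage_scores_exist:
  fixes X :: "'a set" and w :: "'a \<Rightarrow> real" and S :: "('a \<Rightarrow> real) set"
  assumes "finite X" "\<And>x. x \<in> X \<Longrightarrow> w x > 0" "finite S"
  obtains h where "(\<Sum>x\<in>X. w x * h x) \<le> real (card S)"
    "\<forall>g\<in>fun_vs.span S. \<forall>x\<in>X. (g x)\<^sup>2 \<le> h x * weighted_ip X w g g"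
proof -
  obtain B where B: "finite B" "card B \<le> card S" "B \<subseteq> fun_vs.span S" "orthonormal_family X w B"
    and rep: "\<forall>g\<in>fun_vs.span S. \<forall>x\<in>X. g x = (\<Sum>b\<in>B. weighted_ip X w g b * b x)"
    by (rule orthonormal_family_exists[OF assms])
  have "(\<Sum>x\<in>X. w x * (\<Sum>b\<in>B. (b x)\<^sup>2)) = (\<Sum>b\<in>B. weighted_ip X w b b)"
    unfolding weighted_ip_def sum_distrib_left
    by (subst sum.swap) (simp add: power2_eq_square mult.assoc)
  also have "\<dots> = real (card B)"
    using B(4) by (simp add: orthonormal_family_def)
  finally have "(\<Sum>x\<in>X. w x * (\<Sum>b\<in>B. (b x)\<^sup>2)) \<le> real (card S)"
    using B(2) by simp
  moreover have "(g x)\<^sup>2 \<le> (\<Sum>b\<in>B. (b x)\<^sup>2) * weighted_ip X w g g"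
    if "g \<in> fun_vs.span S" "x \<in> X" for g x
  proof -
    have "(g x)\<^sup>2 = (\<Sum>b\<in>B. weighted_ip X w g b * b x)\<^sup>2"
      using rep that by metis
    also have "\<dots> \<le> (\<Sum>b\<in>B. (weighted_ip X w g b)\<^sup>2) * (\<Sum>b\<in>B. (b x)\<^sup>2)"
      by (rule Cauchy_Schwarz_ineq_sum)
    also have "(\<Sum>b\<in>B. (weighted_ip X w g b)\<^sup>2) = weighted_ip X w g g"
      using rep that(1) by (intro weighted_ip_self_orthonormal[symmetric]) blast
    finally show ?thesis by (simp add: mult.commute)
  qed
  ultimately show thesis
    by (intro that[of "\<lambda>x. \<Sum>b\<in>B. (b x)\<^sup>2"]) auto
qed

section \<open>John weights and factorization of sign matrices\<close>

lemma prod_le_mean_power: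
  fixes q :: "nat \<Rightarrow> real"
  assumes "n > 0" "\<And>t. t < n \<Longrightarrow> q t \<ge> 0"
  shows "(\<Prod>t<n. q t) \<le> ((\<Sum>t<n. q t) / n) ^ n"
proof -
  have P: "(\<Prod>t<n. q t) \<ge> 0"
    using assms by (intro prod_nonneg) auto
  have "(\<Prod>t<n. q t) powr (1 / card {..<n}) \<le> (\<Sum>t<n. q t / card {..<n})"
    using assms by (intro arith_geom_mean) auto
  then have "(\<Prod>t<n. q t) powr (1 / n) \<le> (\<Sum>t<n. q t) / n"
    by (simp add: sum_divide_distrib)
  then have "((\<Prod>t<n. q t) powr (1 / n)) ^ n \<le> ((\<Sum>t<n. q t) / n) ^ n"
    by (intro power_mono) auto
  moreover have "((\<Prod>t<n. q t) powr (1 / n)) ^ n = (\<Prod>t<n. q t)"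
  \<comment> \<open>\<open>powr_realpow\<close> asks for a positive base, so a zero product is
    handled apart.\<close>
  proof (cases "(\<Prod>t<n. q t) = 0")
    case True
    then show ?thesis using assms(1) by (simp only: powr_zero_eq_one powr_0 power_0_left) simp
  next
    case False
    then have "((\<Prod>t<n. q t) powr (1 / n)) powr real n = (\<Prod>t<n. q t)"
      using P assms(1) by (simp add: powr_powr)
    then show ?thesis
      using False P by (simp add: powr_realpow)
  qed
  ultimately show ?thesis by simp
qed

text \<open>The last assumption makes every leverage score positive, so all weights of the iteration
  stay positive. No limit is taken: averaging over \<open>card X\<close> steps costs only the factor
  2.\<close>

lemma john_weights_exist:
  fixes X :: "'a set" and S :: "('a \<Rightarrow> real) set"
  assumes fin: "finite X" and ne: "X \<noteq> {}" and S: "finite S"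
    and nz: "\<And>x. x \<in> X \<Longrightarrow> \<exists>g\<in>fun_vs.span S. g x \<noteq> 0"
  obtains w where "\<forall>x\<in>X. w x > 0" "(\<Sum>x\<in>X. w x) \<le> 1"
    "\<forall>g\<in>fun_vs.span S. \<forall>x\<in>X. (g x)\<^sup>2 \<le> 2 * real (card S) * weighted_ip X w g g"
proof -
  define r where "r = real (card S)"
  have "S \<noteq> {}"
    using ne nz by (auto simp: fun_vs.span_empty)
  then have r: "r > 0"
    using S by (simp add: r_def card_gt_0_iff)
  define n where "n = card X"
  have n: "n > 0"
    using fin ne by (simp add: n_def card_gt_0_iff)
  \<comment> \<open>The scores are chosen for all weights at once, because the recursion below feeds
    its own weights to them; the implication makes the choice total.\<close>
  have "\<forall>w. \<exists>h. (\<forall>x\<in>X. w x > 0) \<longrightarrow> (\<Sum>x\<in>X. w x * h x) \<le> r \<and>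
      (\<forall>g\<in>fun_vs.span S. \<forall>x\<in>X. (g x)\<^sup>2 \<le> h x * weighted_ip X w g g)"
  proof
    fix w :: "'a \<Rightarrow> real"
    show "\<exists>h. (\<forall>x\<in>X. w x > 0) \<longrightarrow> (\<Sum>x\<in>X. w x * h x) \<le> r \<and>
      (\<forall>g\<in>fun_vs.span S. \<forall>x\<in>X. (g x)\<^sup>2 \<le> h x * weighted_ip X w g g)"
    proof (cases "\<forall>x\<in>X. w x > 0")
      case True
      then show ?thesis
        using leverage_scores_exist[OF fin _ S, of w] unfolding r_def by blast
    qed auto
  qed
  from choice[OF this] obtain H where H: "\<forall>w. (\<forall>x\<in>X. w x > 0) \<longrightarrow> (\<Sum>x\<in>X. w x * H w x) \<le> r \<and>
      (\<forall>g\<in>fun_vs.span S. \<forall>x\<in>X. (g x)\<^sup>2 \<le> H w x * weighted_ip X w g g)"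
    by blast
  have H_pos: "H w x > 0" if "\<forall>x\<in>X. w x > 0" "x \<in> X" for w x
  proof -
    obtain g where g: "g \<in> fun_vs.span S" "g x \<noteq> 0"
      using nz[OF \<open>x \<in> X\<close>] by blast
    then have "0 < (g x)\<^sup>2" by simp
    also have "(g x)\<^sup>2 \<le> H w x * weighted_ip X w g g"
      using H that g(1) by blast
    finally show ?thesis
      using weighted_ip_self_nonneg[of X w g] that(1)
      by (metis less_imp_le not_less zero_less_mult_iff)
  qed
  \<comment> \<open>reweighting by leverage scores; as \<open>H\<close> at step \<open>t\<close> is \<open>r\<close> times the quotient of consecutive weights,
    the product of the scores over time telescopes\<close>
  define L where "L = rec_nat (\<lambda>_. 1 / real n) (\<lambda>_ w x. w x * H w x / r)"
  have L_0: "L 0 x = 1 / real n" and L_Suc: "L (Suc t) x = L t x * H (L t) x / r" for t x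
    by (simp_all add: L_def)
  have L: "(\<forall>x\<in>X. L t x > 0) \<and> (\<Sum>x\<in>X. L t x) \<le> 1" for t
  proof (induction t)
    case 0
    then show ?case using n by (simp add: L_0 n_def)
  next
    case (Suc t)
    have "(\<Sum>x\<in>X. L (Suc t) x) = (\<Sum>x\<in>X. L t x * H (L t) x) / r"
      by (simp add: L_Suc sum_divide_distrib)
    also have "\<dots> \<le> 1"
      using H Suc r by (simp add: divide_le_eq_1)
    finally show ?case
      using Suc H_pos[of "L t"] r by (simp add: L_Suc)
  qed
  have prod_H: "(\<Prod>t<T. H (L t) x) = r ^ T * (L T x * real n)" if "x \<in> X" for T x
  proof (induction T)
    case 0
    then show ?case using n by (simp add: L_0)
  next
    case (Suc T)
    then show ?case using r by (simp add: L_Suc)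
  qed
  \<comment> \<open>The total mass bounds \<open>L n x\<close> by 1, and
    \<open>n \<le> 2 ^ n\<close> absorbs the factor \<open>n\<close> left by the uniform start. This
    is the source of the factor 2.\<close>
  have prod_H_le: "(\<Prod>t<n. H (L t) x) \<le> (2 * r) ^ n" if "x \<in> X" for x
  proof -
    have "L n x \<le> (\<Sum>x\<in>X. L n x)"
      using L[of n] that fin by (intro member_le_sum) (auto intro: less_imp_le)
    then have "L n x \<le> 1"
      using L[of n] by linarith
    then have "L n x * real n \<le> 1 * 2 ^ n"
      using L[of n] that of_nat_less_two_power[of n]
      by (intro mult_mono) (auto intro: less_imp_le)
    then show ?thesis
      using r by (simp add: prod_H[OF that] power_mult_distrib mult.commute)
  qed
  define w where "w = (\<lambda>x. (\<Sum>t<n. L t x) / n)"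
  have w_pos: "\<forall>x\<in>X. w x > 0"
    using L n by (auto simp: w_def intro!: divide_pos_pos sum_pos)
  have "(\<Sum>x\<in>X. w x) = (\<Sum>t<n. \<Sum>x\<in>X. L t x) / n"
    unfolding w_def sum_divide_distrib[symmetric] by (subst sum.swap) simp
  also have "\<dots> \<le> (\<Sum>t<n. 1) / n"
    using L by (intro divide_right_mono sum_mono) auto
  finally have w_sum: "(\<Sum>x\<in>X. w x) \<le> 1"
    using n by simp
  have "(g x)\<^sup>2 \<le> 2 * r * weighted_ip X w g g" if "g \<in> fun_vs.span S" "x \<in> X" for g x
  proof -
    define q where "q = (\<lambda>t. weighted_ip X (L t) g g)"
    have q: "q t \<ge> 0" for t
      unfolding q_def using L[of t] by (intro weighted_ip_self_nonneg) (auto intro: less_imp_le)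
    have q_mean: "weighted_ip X w g g = (\<Sum>t<n. q t) / n"
      unfolding q_def weighted_ip_def w_def sum_divide_distrib
      by (subst sum.swap) (simp add: sum_distrib_right sum_divide_distrib)
    \<comment> \<open>The bounds for the single weights are multiplied, so that the scores enter
      only through their telescoping product; the proof ends by taking \<open>n\<close>-th
      roots.\<close>
    have "((g x)\<^sup>2) ^ n = (\<Prod>t<n. (g x)\<^sup>2)"
      by simp
    also have "\<dots> \<le> (\<Prod>t<n. H (L t) x * q t)"
      using H L that by (intro prod_mono) (auto simp: q_def)
    also have "\<dots> = (\<Prod>t<n. H (L t) x) * (\<Prod>t<n. q t)"
      by (rule prod.distrib)
    also have "\<dots> \<le> (2 * r) ^ n * ((\<Sum>t<n. q t) / n) ^ n"
      using prod_H_le[OF that(2)] prod_le_mean_power[OF n, of q] q r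
      by (intro mult_mono) (auto intro: prod_nonneg)
    also have "\<dots> = (2 * r * weighted_ip X w g g) ^ n"
      unfolding q_mean by (rule power_mult_distrib[symmetric])
    finally have "((g x)\<^sup>2) ^ n \<le> (2 * r * weighted_ip X w g g) ^ n" .
    moreover have "0 \<le> 2 * r * weighted_ip X w g g"
      using r w_pos by (intro mult_nonneg_nonneg weighted_ip_self_nonneg) (auto intro: less_imp_le)
    ultimately show ?thesis
      using n by (simp add: power_mono_iff)
  qed
  then show thesis
    using w_pos w_sum by (intro that[of w]) (auto simp: r_def)
qed

text \<open>\<open>u x\<close> lists the values at \<open>x\<close> of an orthonormal basis for the
  John weight, \<open>v y\<close> the coordinates of column \<open>y\<close>. In other terms, a sign
  matrix of rank \<open>r\<close> has gamma_2 norm at most \<open>sqrt (2 * r)\<close>.\<close>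

lemma sign_matrix_factorization:
  fixes X :: "'a set" and Y :: "'b set" and M :: "'a \<Rightarrow> 'b \<Rightarrow> real"
  assumes fin: "finite X" "finite Y" and ne: "X \<noteq> {}" "Y \<noteq> {}"
    and M: "\<And>x y. x \<in> X \<Longrightarrow> y \<in> Y \<Longrightarrow> M x y \<in> {-1, 1}"
  obtains I :: "('a \<Rightarrow> real) set" and u v where "finite I"
    "\<forall>x\<in>X. (\<Sum>i\<in>I. (u x i)\<^sup>2) \<le> 2 * real (matrix_rank X Y M)"
    "\<forall>y\<in>Y. (\<Sum>i\<in>I. (v y i)\<^sup>2) \<le> 1"
    "\<forall>x\<in>X. \<forall>y\<in>Y. (\<Sum>i\<in>I. u x i * v y i) = M x y"
proof -
  define col where "col = (\<lambda>y x. if x \<in> X then M x y else 0)"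
  obtain S where S: "S \<subseteq> col ` Y" "col ` Y \<subseteq> fun_vs.span S" "card S = fun_vs.dim (col ` Y)"
    using fun_vs.basis_exists[of "col ` Y"] by metis
  have rank: "card S = matrix_rank X Y M"
    using S(3) by (simp add: matrix_rank_def col_def)
  have S_fin: "finite S"
    using S(1) fin by (meson finite_imageI finite_subset)
  have col_span: "col y \<in> fun_vs.span S" if "y \<in> Y" for y
    using S(2) that by blast
  have col_sq: "(col y x)\<^sup>2 = 1" if "x \<in> X" "y \<in> Y" for x y
    using M[OF that] that by (auto simp: col_def)
  \<comment> \<open>A column of signs vanishes nowhere on \<open>X\<close>.\<close>
  have "\<exists>g\<in>fun_vs.span S. g x \<noteq> 0" if "x \<in> X" for x
    using ne(2) col_span col_sq[OF that] by fastforce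
  then obtain w where w: "\<forall>x\<in>X. w x > 0" "(\<Sum>x\<in>X. w x) \<le> 1"
    and john: "\<forall>g\<in>fun_vs.span S. \<forall>x\<in>X. (g x)\<^sup>2 \<le> 2 * real (card S) * weighted_ip X w g g"
    using john_weights_exist[OF fin(1) ne(1) S_fin] by metis
  obtain B where B: "finite B" "card B \<le> card S" "B \<subseteq> fun_vs.span S" "orthonormal_family X w B"
    and rep: "\<forall>g\<in>fun_vs.span S. \<forall>x\<in>X. g x = (\<Sum>b\<in>B. weighted_ip X w g b * b x)"
    using orthonormal_family_exists[OF fin(1) _ S_fin, of w] w(1) by blast
  have "(\<Sum>b\<in>B. (b x)\<^sup>2) \<le> 2 * real (card S)" if "x \<in> X" for x
  proof -
    define s where "s = (\<Sum>b\<in>B. (b x)\<^sup>2)"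
    \<comment> \<open>the reproducing kernel at \<open>x\<close>: its value at \<open>x\<close> and its squared norm are both \<open>s\<close>\<close>
    define k where "k = (\<lambda>z. \<Sum>b\<in>B. b x * b z)"
    have k_span: "k \<in> fun_vs.span S"
      unfolding k_def using B(1,3) by (intro fun_span_sum) auto
    have k_ip: "weighted_ip X w k b = b x" if "b \<in> B" for b
    proof -
      have "weighted_ip X w k b = (\<Sum>c\<in>B. c x * weighted_ip X w c b)"
        unfolding k_def by (rule weighted_ip_sum_left)
      also have "\<dots> = (\<Sum>c\<in>B. if c = b then c x else 0)"
        using B(4) that by (intro sum.cong) (auto simp: orthonormal_family_def)
      finally show ?thesis using B(1) that by simp
    qed
    have "weighted_ip X w k k = (\<Sum>b\<in>B. (weighted_ip X w k b)\<^sup>2)"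
      using rep k_span by (intro weighted_ip_self_orthonormal) blast
    then have "weighted_ip X w k k = s"
      by (simp add: k_ip s_def)
    moreover have "k x = s"
      by (simp add: k_def s_def power2_eq_square)
    ultimately have "s\<^sup>2 \<le> 2 * real (card S) * s"
      using john k_span that by metis
    moreover have "s \<ge> 0"
      by (simp add: s_def sum_nonneg)
    ultimately show ?thesis
      unfolding s_def[symmetric]
      by (cases "s = 0") (auto simp: power2_eq_square)
  qed
  moreover have "(\<Sum>b\<in>B. (weighted_ip X w (col y) b)\<^sup>2) \<le> 1" if "y \<in> Y" for y
  proof -
    have "(\<Sum>b\<in>B. (weighted_ip X w (col y) b)\<^sup>2) = weighted_ip X w (col y) (col y)"
      using rep col_span[OF that] by (intro weighted_ip_self_orthonormal[symmetric]) blast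
    also have "\<dots> = (\<Sum>x\<in>X. w x * (col y x)\<^sup>2)"
      by (simp add: weighted_ip_def power2_eq_square mult.assoc)
    also have "\<dots> = (\<Sum>x\<in>X. w x)"
      using col_sq that by simp
    finally show ?thesis using w(2) by simp
  qed
  moreover have "(\<Sum>b\<in>B. b x * weighted_ip X w (col y) b) = M x y" if "x \<in> X" "y \<in> Y" for x y
  proof -
    have "(\<Sum>b\<in>B. b x * weighted_ip X w (col y) b) = col y x"
      using rep col_span[OF that(2)] that(1) by (simp add: mult.commute)
    then show ?thesis using that by (simp add: col_def)
  qed
  ultimately show thesis
    using B(1) rank
    by (intro that[of B "\<lambda>x b. b x" "\<lambda>y b. weighted_ip X w (col y) b"]) auto
qed

section \<open>Gaussian correlations of sines\<close>

lemma gaussian_product_prob_space: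
  "prob_space (Pi\<^sub>M I (\<lambda>_. std_normal_distribution))"
  using prob_space_normal_density[of 1 0] by (intro prob_space_PiM) simp

text \<open>The cosine is the real part of \<open>iexp\<close>, whose integral factors over the
  independent coordinates into values of the normal characteristic function.\<close>

lemma gaussian_integral_cos:
  assumes "finite I"
  shows "(\<integral>g. cos (\<Sum>i\<in>I. w i * g i) \<partial>Pi\<^sub>M I (\<lambda>_. std_normal_distribution))
    = exp (- (\<Sum>i\<in>I. (w i)\<^sup>2) / 2)"
proof -
  let ?N = "std_normal_distribution"
  let ?P = "Pi\<^sub>M I (\<lambda>_::'a. ?N)"
  interpret N: real_distribution ?N
    by (rule real_dist_normal_dist)
  interpret PN: product_sigma_finite "\<lambda>_::'a. ?N"
    by standard
  have int: "integrable ?N (\<lambda>t. iexp (w i * t))" for i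
    by (rule N.integrable_const_bound[of _ 1]) auto
  have prod_iexp: "(\<Prod>i\<in>I. iexp (w i * g i)) = iexp (\<Sum>i\<in>I. w i * g i)" for g
    using assms by (simp add: exp_sum sum_distrib_left)
  have "integrable ?P (\<lambda>g. \<Prod>i\<in>I. iexp (w i * g i))"
    using PN.product_integrable_prod[of I "\<lambda>i t. iexp (w i * t)"] assms int by simp
  then have int_P: "integrable ?P (\<lambda>g. iexp (\<Sum>i\<in>I. w i * g i))"
    by (simp only: prod_iexp)
  have "(\<integral>g. iexp (\<Sum>i\<in>I. w i * g i) \<partial>?P) = (\<integral>g. (\<Prod>i\<in>I. iexp (w i * g i)) \<partial>?P)"
    by (simp only: prod_iexp)
  also have "\<dots> = (\<Prod>i\<in>I. \<integral>t. iexp (w i * t) \<partial>?N)"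
    using PN.product_integral_prod[of I "\<lambda>i t. iexp (w i * t)"] assms int by simp
  also have "\<dots> = (\<Prod>i\<in>I. char ?N (w i))"
    by (simp add: char_def)
  also have "\<dots> = complex_of_real (\<Prod>i\<in>I. exp (- (w i)\<^sup>2 / 2))"
    by (simp only: char_std_normal_distribution of_real_prod)
  also have "(\<Prod>i\<in>I. exp (- (w i)\<^sup>2 / 2)) = exp (- (\<Sum>i\<in>I. (w i)\<^sup>2) / 2)"
    using assms by (simp only: exp_sum[symmetric]) (simp add: sum_negf sum_divide_distrib)
  finally have "Re (\<integral>g. iexp (\<Sum>i\<in>I. w i * g i) \<partial>?P) = exp (- (\<Sum>i\<in>I. (w i)\<^sup>2) / 2)"
    by (simp only: Re_complex_of_real)
  moreover have "Re (\<integral>g. iexp (\<Sum>i\<in>I. w i * g i) \<partial>?P)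
      = (\<integral>g. Re (iexp (\<Sum>i\<in>I. w i * g i)) \<partial>?P)"
    by (rule integral_Re[OF int_P, symmetric])
  moreover have "Re (iexp t) = cos t" for t
    by (simp add: Re_exp)
  ultimately show ?thesis by (simp only:)
qed

text \<open>The product-to-sum formula reduces to cosines of \<open>u - v\<close> and
  \<open>u + v\<close>. Their squared norms differ only in the sign of the cross term, which leaves
  a difference of exponentials, that is, \<open>sinh\<close>.\<close>

lemma gaussian_integral_sin_sin:
  assumes "finite I"
  shows "(\<integral>g. sin (\<Sum>i\<in>I. u i * g i) * sin (\<Sum>i\<in>I. v i * g i)
            \<partial>Pi\<^sub>M I (\<lambda>_. std_normal_distribution))
    = exp (- ((\<Sum>i\<in>I. (u i)\<^sup>2) + (\<Sum>i\<in>I. (v i)\<^sup>2)) / 2) * sinh (\<Sum>i\<in>I. u i * v i)"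
proof -
  let ?P = "Pi\<^sub>M I (\<lambda>_::'a. std_normal_distribution)"
  interpret P: prob_space ?P
    by (rule gaussian_product_prob_space)
  let ?U = "\<Sum>i\<in>I. (u i)\<^sup>2" and ?V = "\<Sum>i\<in>I. (v i)\<^sup>2" and ?W = "\<Sum>i\<in>I. u i * v i"
  have int: "integrable ?P (\<lambda>g. cos (\<Sum>i\<in>I. w i * g i))" for w
    by (rule P.integrable_const_bound[of _ 1]) auto
  have "sin (\<Sum>i\<in>I. u i * g i) * sin (\<Sum>i\<in>I. v i * g i)
      = (cos (\<Sum>i\<in>I. (u i - v i) * g i) - cos (\<Sum>i\<in>I. (u i + v i) * g i)) / 2" for g
    by (simp add: sin_times_sin left_diff_distrib distrib_right sum_subtractf sum.distrib)
  then have "(\<integral>g. sin (\<Sum>i\<in>I. u i * g i) * sin (\<Sum>i\<in>I. v i * g i) \<partial>?P)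
      = (\<integral>g. (cos (\<Sum>i\<in>I. (u i - v i) * g i) - cos (\<Sum>i\<in>I. (u i + v i) * g i)) / 2 \<partial>?P)"
    by (simp only:)
  also have "\<dots> = (exp (- (\<Sum>i\<in>I. (u i - v i)\<^sup>2) / 2) - exp (- (\<Sum>i\<in>I. (u i + v i)\<^sup>2) / 2)) / 2"
    using int by (simp add: gaussian_integral_cos[OF assms])
  also have "(\<Sum>i\<in>I. (u i - v i)\<^sup>2) = ?U + ?V - 2 * ?W"
    by (simp add: power2_diff sum.distrib sum_subtractf sum_distrib_left mult.assoc)
  also have "(\<Sum>i\<in>I. (u i + v i)\<^sup>2) = ?U + ?V + 2 * ?W"
    by (simp add: power2_sum sum.distrib sum_distrib_left mult.assoc)
  also have "exp (- (?U + ?V - 2 * ?W) / 2) = exp (- (?U + ?V) / 2) * exp ?W"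
    by (simp flip: exp_add add: field_simps)
  also have "exp (- (?U + ?V + 2 * ?W) / 2) = exp (- (?U + ?V) / 2) * exp (- ?W)"
    by (simp flip: exp_add add: field_simps)
  finally show ?thesis
    by (simp add: sinh_field_def algebra_simps)
qed

lemma sinh_ge_self:
  fixes x :: real
  assumes "x \<ge> 0"
  shows "sinh x \<ge> x"
  using real_le_x_sinh[OF assms] by (simp add: sinh_field_def exp_minus)

section \<open>Rounding to rectangles\<close>

lemma sum_weighted_le_sum_nonneg_part:
  fixes s c :: "'a \<Rightarrow> real"
  assumes "finite A" "\<And>x. x \<in> A \<Longrightarrow> c x \<in> {0..1}"
  shows "(\<Sum>x\<in>A. c x * s x) \<le> (\<Sum>x\<in>{x\<in>A. s x \<ge> 0}. s x)"
proof -
  have "(\<Sum>x\<in>A. c x * s x) \<le> (\<Sum>x\<in>A. if s x \<ge> 0 then s x else 0)"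
  proof (intro sum_mono)
    fix x assume "x \<in> A"
    then have "0 \<le> c x" "c x \<le> 1"
      using assms(2) by auto
    then show "c x * s x \<le> (if s x \<ge> 0 then s x else 0)"
      by (auto simp: mult_left_le_one_le mult_nonneg_nonpos)
  qed
  also have "\<dots> = (\<Sum>x\<in>{x\<in>A. s x \<ge> 0}. s x)"
    using assms(1) by (simp add: sum.inter_filter)
  finally show ?thesis .
qed

text \<open>A bilinear form on a product of cubes is largest at vertices, and a pair of vertices is
  a rectangle. Round \<open>a\<close> with \<open>b\<close> fixed, then \<open>b\<close> for the
  rounded \<open>a\<close>.\<close>

lemma bilinear_le_rectangle_sum:
  fixes Q :: "'a \<times> 'b \<Rightarrow> real"
  assumes fin: "finite X" "finite Y"
    and a: "\<And>x. x \<in> X \<Longrightarrow> a x \<in> {0..1}" and b: "\<And>y. y \<in> Y \<Longrightarrow> b y \<in> {0..1}"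
  shows "\<exists>X'\<subseteq>X. \<exists>Y'\<subseteq>Y. (\<Sum>x\<in>X. \<Sum>y\<in>Y. Q (x, y) * (a x * b y)) \<le> (\<Sum>z\<in>X'\<times>Y'. Q z)"
proof -
  define s where "s = (\<lambda>x. \<Sum>y\<in>Y. Q (x, y) * b y)"
  define X' where "X' = {x\<in>X. s x \<ge> 0}"
  define t where "t = (\<lambda>y. \<Sum>x\<in>X'. Q (x, y))"
  define Y' where "Y' = {y\<in>Y. t y \<ge> 0}"
  have "(\<Sum>x\<in>X. \<Sum>y\<in>Y. Q (x, y) * (a x * b y)) = (\<Sum>x\<in>X. a x * s x)"
    by (simp add: s_def sum_distrib_left algebra_simps)
  also have "\<dots> \<le> (\<Sum>x\<in>X'. s x)"
    unfolding X'_def using fin a by (intro sum_weighted_le_sum_nonneg_part) auto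
  also have "\<dots> = (\<Sum>y\<in>Y. b y * t y)"
    unfolding s_def t_def by (subst sum.swap) (simp add: sum_distrib_left mult.commute)
  also have "\<dots> \<le> (\<Sum>y\<in>Y'. t y)"
    unfolding Y'_def using fin b by (intro sum_weighted_le_sum_nonneg_part) auto
  also have "\<dots> = (\<Sum>z\<in>X'\<times>Y'. Q z)"
    unfolding t_def by (subst sum.swap) (simp add: sum.cartesian_product)
  finally show ?thesis
    by (intro exI[of _ X'] exI[of _ Y'] conjI) (auto simp: X'_def Y'_def)
qed

text \<open>Probabilistic rounding: fix an outcome \<open>g\<close> that does at least as well as
  the average, then read \<open>a\<close> and \<open>b\<close> as fractional memberships in a
  rectangle.\<close>

lemma correlation_le_rectangle_sum:
  fixes Q :: "'a \<times> 'b \<Rightarrow> real" and a :: "'a \<Rightarrow> 'g \<Rightarrow> real" and b :: "'b \<Rightarrow> 'g \<Rightarrow> real"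
  assumes P: "prob_space P" and fin: "finite X" "finite Y"
    and meas: "\<And>x. a x \<in> borel_measurable P" "\<And>y. b y \<in> borel_measurable P"
    and bnd: "\<And>x g. \<bar>a x g\<bar> \<le> 1" "\<And>y g. \<bar>b y g\<bar> \<le> 1"
  shows "\<exists>X'\<subseteq>X. \<exists>Y'\<subseteq>Y.
    (\<Sum>x\<in>X. \<Sum>y\<in>Y. Q (x, y) * ((1 + (\<integral>g. a x g * b y g \<partial>P)) / 4)) \<le> (\<Sum>z\<in>X'\<times>Y'. Q z)"
proof -
  interpret prob_space P by (rule P)
  define F where "F = (\<lambda>g. \<Sum>x\<in>X. \<Sum>y\<in>Y. Q (x, y) * ((1 + a x g * b y g) / 4))"
  define E where "E = (\<Sum>x\<in>X. \<Sum>y\<in>Y. Q (x, y) * ((1 + (\<integral>g. a x g * b y g \<partial>P)) / 4))"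
  have int: "integrable P (\<lambda>g. a x g * b y g)" for x y
  proof (rule integrable_const_bound[of _ 1])
    show "AE g in P. norm (a x g * b y g) \<le> 1"
      using bnd by (auto simp: abs_mult intro!: mult_le_one)
  qed (use meas in measurable)
  have F_int: "integrable P F" and F_eq: "(\<integral>g. F g \<partial>P) = E"
    unfolding F_def E_def using int by (simp_all add: prob_space)
  \<comment> \<open>Some outcome reaches the mean.\<close>
  have "\<exists>g. F g \<ge> E"
  proof (rule ccontr)
    assume "\<not> (\<exists>g. F g \<ge> E)"
    then have "expectation F < E"
      using F_int by (intro expectation_less) (auto simp: not_le)
    then show False using F_eq by simp
  qed
  then obtain g where g: "F g \<ge> E" by blast
  \<comment> \<open>The two choices of the sign \<open>\<sigma>\<close> average to
    \<open>(1 + a x g * b y g) / 4\<close>: the linear terms cancel. So one of them is at least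
    \<open>F g\<close>.\<close>
  define G where "G = (\<lambda>\<sigma>::real. \<Sum>x\<in>X. \<Sum>y\<in>Y. Q (x, y) * ((1 + \<sigma> * a x g) / 2 * ((1 + \<sigma> * b y g) / 2)))"
  have "G 1 + G (-1) = 2 * F g"
    unfolding G_def F_def sum_distrib_left sum.distrib[symmetric]
    by (intro sum.cong refl) (simp add: field_simps)
  then have "G 1 \<ge> F g \<or> G (-1) \<ge> F g"
    by linarith
  then obtain \<sigma> where \<sigma>: "\<sigma> = 1 \<or> \<sigma> = -1" "G \<sigma> \<ge> F g"
    by blast
  have "(1 + \<sigma> * a x g) / 2 \<in> {0..1}" "(1 + \<sigma> * b y g) / 2 \<in> {0..1}" for x y
    using \<sigma>(1) bnd(1)[of x g] bnd(2)[of y g] by (auto simp: abs_le_iff)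
  then obtain X' Y' where "X' \<subseteq> X" "Y' \<subseteq> Y" "G \<sigma> \<le> (\<Sum>z\<in>X'\<times>Y'. Q z)"
    unfolding G_def using bilinear_le_rectangle_sum[OF fin, of "\<lambda>x. (1 + \<sigma> * a x g) / 2" "\<lambda>y. (1 + \<sigma> * b y g) / 2" Q]
    by blast
  then show ?thesis
    using g \<sigma>(2) unfolding E_def by (meson order_trans)
qed

text \<open>Each rectangle is chosen for the weight already multiplied by the factors of the
  remaining \<open>k\<close> steps; the induction hypothesis then acts on the weight cut down to
  that rectangle. Intersections of rectangles are rectangles.\<close>

lemma rectangle_amplification:
  fixes f :: "'a \<times> 'b \<Rightarrow> real" and p :: "real \<Rightarrow> real"
  assumes fin: "finite X" "finite Y" and p: "\<And>z. z \<in> X \<times> Y \<Longrightarrow> p (f z) \<ge> 0"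
    and step: "\<And>c. (\<And>z. c z \<ge> 0) \<Longrightarrow> \<exists>X'\<subseteq>X. \<exists>Y'\<subseteq>Y.
      (\<Sum>z\<in>X\<times>Y. f z * c z * p (f z)) \<le> (\<Sum>z\<in>X'\<times>Y'. f z * c z)"
    and c: "\<And>z. c z \<ge> 0"
  shows "\<exists>X'\<subseteq>X. \<exists>Y'\<subseteq>Y. (\<Sum>z\<in>X\<times>Y. f z * c z * p (f z) ^ k) \<le> (\<Sum>z\<in>X'\<times>Y'. f z * c z)"
  using c
proof (induction k arbitrary: c)
  case 0
  then show ?case by auto
next
  case (Suc k)
  \<comment> \<open>\<open>p (f z)\<close> is known to be nonnegative only on
    \<open>X \<times> Y\<close>, while \<open>step\<close> wants a weight that is nonnegative
    everywhere.\<close>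
  define c' where "c' = (\<lambda>z. if z \<in> X \<times> Y then c z * p (f z) ^ k else 0)"
  have "c' z \<ge> 0" for z
    using Suc.prems p by (simp add: c'_def)
  then obtain X1 Y1 where 1: "X1 \<subseteq> X" "Y1 \<subseteq> Y"
    "(\<Sum>z\<in>X\<times>Y. f z * c' z * p (f z)) \<le> (\<Sum>z\<in>X1\<times>Y1. f z * c' z)"
    using step by meson
  define c1 where "c1 = (\<lambda>z. if z \<in> X1 \<times> Y1 then c z else 0)"
  have "c1 z \<ge> 0" for z
    using Suc.prems by (simp add: c1_def)
  then obtain X2 Y2 where 2: "X2 \<subseteq> X" "Y2 \<subseteq> Y"
    "(\<Sum>z\<in>X\<times>Y. f z * c1 z * p (f z) ^ k) \<le> (\<Sum>z\<in>X2\<times>Y2. f z * c1 z)"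
    using Suc.IH by meson
  have "(\<Sum>z\<in>X\<times>Y. f z * c z * p (f z) ^ Suc k) = (\<Sum>z\<in>X\<times>Y. f z * c' z * p (f z))"
    by (intro sum.cong) (auto simp: c'_def)
  also note 1(3)
  also have "(\<Sum>z\<in>X1\<times>Y1. f z * c' z) = (\<Sum>z\<in>X\<times>Y. f z * c1 z * p (f z) ^ k)"
    using fin 1(1,2) by (intro sum.mono_neutral_cong_left) (auto simp: c'_def c1_def)
  also note 2(3)
  also have "(\<Sum>z\<in>X2\<times>Y2. f z * c1 z) = (\<Sum>z\<in>(X1 \<inter> X2)\<times>(Y1 \<inter> Y2). f z * c z)"
    using finite_subset[OF 2(1) fin(1)] finite_subset[OF 2(2) fin(2)]
    by (intro sum.mono_neutral_cong_right) (auto simp: c1_def)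
  finally show ?case
    using 1(1,2) by (intro exI[of _ "X1 \<inter> X2"] exI[of _ "Y1 \<inter> Y2"] conjI) auto
qed

section \<open>Correlations and rectangles for sign matrices\<close>

lemma sign_matrix_gaussian_correlation:
  fixes f :: "'a \<times> 'b \<Rightarrow> real"
  assumes fin: "finite X" "finite Y" and ne: "X \<noteq> {}" "Y \<noteq> {}"
    and f: "f \<in> X \<times> Y \<rightarrow> {-1, 1}"
    and r: "r = matrix_rank X Y (\<lambda>x y. f (x, y))"
  obtains P :: "(('a \<Rightarrow> real) \<Rightarrow> real) measure" and a b where "prob_space P" "r > 0"
    "\<forall>x. a x \<in> borel_measurable P" "\<forall>y. b y \<in> borel_measurable P"
    "\<forall>x g. \<bar>a x g\<bar> \<le> (1::real)" "\<forall>y g. \<bar>b y g\<bar> \<le> (1::real)"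
    "\<forall>x\<in>X. \<forall>y\<in>Y. f (x, y) * (\<integral>g. a x g * b y g \<partial>P) \<ge> 1 / (5 * sqrt r)"
proof -
  have f': "f (x, y) \<in> {-1, 1}" if "x \<in> X" "y \<in> Y" for x y
    using f that by blast
  obtain I :: "('a \<Rightarrow> real) set" and u v where I: "finite I"
    and u: "\<forall>x\<in>X. (\<Sum>i\<in>I. (u x i)\<^sup>2) \<le> 2 * real r"
    and v: "\<forall>y\<in>Y. (\<Sum>i\<in>I. (v y i)\<^sup>2) \<le> 1"
    and uv: "\<forall>x\<in>X. \<forall>y\<in>Y. (\<Sum>i\<in>I. u x i * v y i) = f (x, y)"
    by (rule sign_matrix_factorization[where M = "\<lambda>x y. f (x, y)", OF fin ne f', folded r])
  \<comment> \<open>Rank 0 would force all \<open>u x\<close>, hence all entries, to be 0. This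
    allows division by \<open>s\<close>.\<close>
  have r_pos: "r > 0"
  proof (rule ccontr)
    assume "\<not> r > 0"
    then have "(\<Sum>i\<in>I. (u x i)\<^sup>2) = 0" if "x \<in> X" for x
      using u that by (force intro: antisym sum_nonneg)
    then have "u x i = 0" if "x \<in> X" "i \<in> I" for x i
      using that I by (simp add: sum_nonneg_eq_0_iff)
    then have "(\<Sum>i\<in>I. u x i * v y i) = 0" if "x \<in> X" for x y
      using that by simp
    then have "f (x, y) = 0" if "x \<in> X" "y \<in> Y" for x y
      using uv that by simp
    moreover obtain x y where "x \<in> X" "y \<in> Y"
      using ne by blast
    ultimately show False
      using f'[of x y] by simp
  qed
  define s where "s = sqrt (2 * real r)"
  have s: "s > 0" "s\<^sup>2 = 2 * real r"
    using r_pos by (simp_all add: s_def)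
  define P where "P = Pi\<^sub>M I (\<lambda>_. std_normal_distribution)"
  \<comment> \<open>Dividing by \<open>s\<close> brings \<open>u x\<close> to norm at most 1, so the
    damping factor of the Gaussian formula is at least \<open>exp (- 1)\<close>, while the inner
    product shrinks only to \<open>f (x, y) / s\<close>.\<close>
  define a where "a = (\<lambda>x g. sin (\<Sum>i\<in>I. (u x i / s) * g i))"
  define b where "b = (\<lambda>y g. sin (\<Sum>i\<in>I. v y i * g i))"
  have corr: "f (x, y) * (\<integral>g. a x g * b y g \<partial>P) \<ge> 1 / (5 * sqrt r)" if xy: "x \<in> X" "y \<in> Y" for x y
  proof -
    define N where "N = (\<Sum>i\<in>I. (u x i / s)\<^sup>2) + (\<Sum>i\<in>I. (v y i)\<^sup>2)"
    have "(\<Sum>i\<in>I. (u x i / s)\<^sup>2) = (\<Sum>i\<in>I. (u x i)\<^sup>2) / s\<^sup>2"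
      by (simp add: power_divide sum_divide_distrib)
    also have "\<dots> \<le> 1"
      using u xy(1) r_pos s by (simp add: divide_le_eq_1)
    finally have N: "N \<le> 2"
      using v xy(2) unfolding N_def by force
    have "(\<Sum>i\<in>I. (u x i / s) * v y i) = f (x, y) / s"
      using uv xy by (simp add: sum_divide_distrib[symmetric])
    then have E: "(\<integral>g. a x g * b y g \<partial>P) = exp (- N / 2) * sinh (f (x, y) / s)"
      unfolding a_def b_def P_def N_def using gaussian_integral_sin_sin[OF I, of "\<lambda>i. u x i / s" "v y"]
      by simp
    have "f (x, y) = -1 \<or> f (x, y) = 1"
      using f'[OF xy] by blast
    \<comment> \<open>\<open>sinh\<close> is odd, so both signs give the same value. The 5 below
      comes from \<open>exp (- 1) \<ge> 1 / 3\<close> and \<open>3 * sqrt 2 \<le> 5\<close>.\<close>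
    then have "f (x, y) * (\<integral>g. a x g * b y g \<partial>P) = exp (- N / 2) * sinh (1 / s)"
      by (auto simp: E)
    also have "\<dots> \<ge> exp (- 1) * (1 / s)"
      using N s(1) by (intro mult_mono sinh_ge_self) auto
    also have "exp (- 1) * (1 / s) \<ge> (1 / 3) * (1 / s)"
      using s(1) exp_le by (intro mult_right_mono) (auto simp: exp_minus field_simps)
    also have "(1 / 3) * (1 / s) \<ge> 1 / (5 * sqrt r)"
    proof -
      have "3 * sqrt 2 \<le> 5"
        by (rule power2_le_imp_le) (auto simp: power_mult_distrib)
      then have "3 * sqrt 2 * sqrt r \<le> 5 * sqrt r"
        by (intro mult_right_mono) auto
      then have "3 * s \<le> 5 * sqrt r"
        by (simp add: s_def real_sqrt_mult)
      then show ?thesis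
        using s(1) by (simp add: frac_le)
    qed
    finally show ?thesis .
  qed
  show thesis
  proof (rule that[of P a b])
    show "prob_space P"
      unfolding P_def by (rule gaussian_product_prob_space)
    show "\<forall>x. a x \<in> borel_measurable P" "\<forall>y. b y \<in> borel_measurable P"
      unfolding a_def b_def P_def by simp_all
  qed (use r_pos corr in \<open>auto simp: a_def b_def\<close>)
qed

text \<open>The true correlations vary from entry to entry. Replacing them by a multiplier that
  depends on \<open>f z\<close> alone loses in the right direction for both signs, and such a
  multiplier can be iterated.\<close>

lemma sign_matrix_rectangle_step:
  fixes f c :: "'a \<times> 'b \<Rightarrow> real"
  assumes fin: "finite X" "finite Y" and ne: "X \<noteq> {}" "Y \<noteq> {}"
    and f: "f \<in> X \<times> Y \<rightarrow> {-1, 1}"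
    and r: "r = matrix_rank X Y (\<lambda>x y. f (x, y))"
    and c: "\<And>z. c z \<ge> 0"
  shows "\<exists>X'\<subseteq>X. \<exists>Y'\<subseteq>Y. (\<Sum>z\<in>X\<times>Y. f z * c z * ((1 + f z / (5 * sqrt r)) / 4))
           \<le> (\<Sum>z\<in>X'\<times>Y'. f z * c z)"
proof -
  obtain P :: "(('a \<Rightarrow> real) \<Rightarrow> real) measure" and a b where P: "prob_space P" "r > 0"
    "\<forall>x. a x \<in> borel_measurable P" "\<forall>y. b y \<in> borel_measurable P"
    "\<forall>x g. \<bar>a x g\<bar> \<le> (1::real)" "\<forall>y g. \<bar>b y g\<bar> \<le> (1::real)"
    and corr: "\<forall>x\<in>X. \<forall>y\<in>Y. f (x, y) * (\<integral>g. a x g * b y g \<partial>P) \<ge> 1 / (5 * sqrt r)"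
    by (rule sign_matrix_gaussian_correlation[OF fin ne f r])
  obtain X' Y' where XY: "X' \<subseteq> X" "Y' \<subseteq> Y" and
    le: "(\<Sum>x\<in>X. \<Sum>y\<in>Y. (f (x, y) * c (x, y)) * ((1 + (\<integral>g. a x g * b y g \<partial>P)) / 4))
      \<le> (\<Sum>z\<in>X'\<times>Y'. f z * c z)"
    using correlation_le_rectangle_sum[OF P(1) fin, of a b "\<lambda>z. f z * c z"] P(3-6) by blast
  have "(\<Sum>z\<in>X\<times>Y. f z * c z * ((1 + f z / (5 * sqrt r)) / 4))
      = (\<Sum>x\<in>X. \<Sum>y\<in>Y. f (x, y) * c (x, y) * ((1 + f (x, y) / (5 * sqrt r)) / 4))"
    by (simp add: sum.cartesian_product case_prod_beta)
  also have "\<dots> \<le> (\<Sum>x\<in>X. \<Sum>y\<in>Y. (f (x, y) * c (x, y)) * ((1 + (\<integral>g. a x g * b y g \<partial>P)) / 4))"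
  proof (intro sum_mono)
    fix x y assume xy: "x \<in> X" "y \<in> Y"
    define E where "E = (\<integral>g. a x g * b y g \<partial>P)"
    define e where "e = 1 / (5 * sqrt r)"
    have "f (x, y) = -1 \<or> f (x, y) = 1"
      using f xy by blast
    then have "f (x, y) * (f (x, y) * e) = e"
      by auto
    also have "e \<le> f (x, y) * E"
      using corr xy by (simp add: E_def e_def)
    finally have "c (x, y) * (f (x, y) * (f (x, y) * e)) \<le> c (x, y) * (f (x, y) * E)"
      using c by (rule mult_left_mono)
    then have "f (x, y) * c (x, y) * ((1 + f (x, y) * e) / 4) \<le> f (x, y) * c (x, y) * ((1 + E) / 4)"
      by (simp add: algebra_simps)
    then show "f (x, y) * c (x, y) * ((1 + f (x, y) / (5 * sqrt r)) / 4)
        \<le> f (x, y) * c (x, y) * ((1 + (\<integral>g. a x g * b y g \<partial>P)) / 4)"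
      by (simp add: E_def e_def)
  qed
  also note le
  finally show ?thesis
    using XY by blast
qed

lemma expectation_cond_pmf_finite:
  fixes f :: "'a \<Rightarrow> real"
  assumes "finite A" "measure_pmf.prob \<mu> A > 0"
  shows "measure_pmf.expectation (cond_pmf \<mu> A) f = (\<Sum>z\<in>A. f z * pmf \<mu> z) / measure_pmf.prob \<mu> A"
proof -
  have ne: "set_pmf \<mu> \<inter> A \<noteq> {}"
    using assms(2) measure_Int_set_pmf[of \<mu> A] by (force simp: Int_commute)
  have "measure_pmf.expectation (cond_pmf \<mu> A) f = (\<Sum>z\<in>A. pmf (cond_pmf \<mu> A) z *\<^sub>R f z)"
    using ne by (intro integral_measure_pmf[OF assms(1)]) auto
  also have "\<dots> = (\<Sum>z\<in>A. f z * pmf \<mu> z) / measure_pmf.prob \<mu> A"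
    by (simp add: pmf_cond[OF ne] sum_divide_distrib mult.commute)
  finally show ?thesis .
qed

section \<open>The rectangle bound\<close>

text \<open>Entries -1 are charged \<open>2 / \<delta>\<close> times their mass. A single lower
  bound on the charged sum over the rectangle then yields both claims: its size gives the mass, its
  positivity the bias.\<close>

lemma biased_rectangle_exists:
  fixes f :: "'a \<times> 'b \<Rightarrow> real" and \<mu> :: "('a \<times> 'b) pmf"
  assumes fin: "finite X" "finite Y" and f: "f \<in> X \<times> Y \<rightarrow> {-1, 1}"
    and r: "r = matrix_rank X Y (\<lambda>x y. f (x, y))"
    and supp: "set_pmf \<mu> \<subseteq> X \<times> Y"
    and \<delta>: "\<delta> > 0" and mass: "measure_pmf.prob \<mu> {z \<in> X \<times> Y. f z = 1} \<ge> \<delta>"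
    and k: "real k \<ge> 10 * sqrt r * ln (2 / \<delta>)"
  shows "r > 0 \<and> (\<exists>X' Y'. X' \<subseteq> X \<and> Y' \<subseteq> Y \<and>
    measure_pmf.prob \<mu> (X' \<times> Y') \<ge> \<delta> / 2 * (1 / 4) ^ k \<and>
    measure_pmf.expectation (cond_pmf \<mu> (X' \<times> Y')) f \<ge> 1 - \<delta>)"
proof -
  have ne: "X \<noteq> {}" "Y \<noteq> {}"
    using supp set_pmf_not_empty[of \<mu>] by auto
  have f_cases: "f z = 1 \<or> f z = -1" if "z \<in> X \<times> Y" for z
    using f that by blast
  have r_pos: "r > 0"
    by (rule sign_matrix_gaussian_correlation[OF fin ne f r])
  define \<eta> where "\<eta> = 1 / (5 * sqrt r)"
  have sqrt_r: "sqrt r \<ge> 1"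
    using r_pos by simp
  have "1 < 5 * sqrt r"
    using sqrt_r by linarith
  then have \<eta>: "0 < \<eta>" "\<eta> < 1"
    unfolding \<eta>_def using r_pos by (auto simp: divide_less_eq)
  define p where "p = (\<lambda>t. (1 + t / (5 * sqrt r)) / 4)"
  have p_1: "p 1 = (1 + \<eta>) / 4" and p_m1: "p (-1) = (1 - \<eta>) / 4"
    by (simp_all add: p_def \<eta>_def)
  have "p (-1) \<le> p 1 * exp (- \<eta>)"
  proof -
    have "1 - \<eta> \<le> exp (- \<eta>)"
      using exp_ge_add_one_self[of "- \<eta>"] by simp
    also have "\<dots> \<le> (1 + \<eta>) * exp (- \<eta>)"
      using \<eta> by simp
    finally show ?thesis
      by (simp add: p_1 p_m1)
  qed
  then have "p (-1) ^ k \<le> (p 1 * exp (- \<eta>)) ^ k"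
    using \<eta> by (intro power_mono) (auto simp: p_m1)
  also have "\<dots> = p 1 ^ k * exp (- (k * \<eta>))"
    by (simp add: power_mult_distrib flip: exp_of_nat_mult)
  \<comment> \<open>Here \<open>k * \<eta>\<close> is at least \<open>2 * ln (2 / \<delta>)\<close>;
    this fixes the constant 10 in the bound on \<open>k\<close>.\<close>
  also have "exp (- (k * \<eta>)) \<le> \<delta>\<^sup>2 / 4"
  proof -
    have "2 * ln (2 / \<delta>) = 10 * sqrt r * ln (2 / \<delta>) * \<eta>"
      using r_pos by (simp add: \<eta>_def)
    also have "\<dots> \<le> k * \<eta>"
      using k \<eta> by (intro mult_right_mono) auto
    finally have "exp (- (k * \<eta>)) \<le> exp (- (2 * ln (2 / \<delta>)))"
      by simp
    also have "\<dots> = inverse ((2 / \<delta>)\<^sup>2)"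
      using \<delta> exp_of_nat_mult[of 2 "ln (2 / \<delta>)"] by (simp add: exp_minus)
    also have "\<dots> = \<delta>\<^sup>2 / 4"
      by (simp add: power_divide)
    finally show ?thesis .
  qed
  finally have pk: "p (-1) ^ k \<le> p 1 ^ k * (\<delta>\<^sup>2 / 4)"
    using \<eta> by (simp add: p_1 mult_left_mono)
  have p1k: "p 1 ^ k \<ge> (1 / 4) ^ k"
    using \<eta> by (intro power_mono) (auto simp: p_1)
  define c where "c = (\<lambda>z. pmf \<mu> z * (if f z = 1 then 1 else 2 / \<delta>))"
  have c: "c z \<ge> 0" for z
    using \<delta> by (simp add: c_def)
  have p_nonneg: "p (f z) \<ge> 0" if "z \<in> X \<times> Y" for z
    using f_cases[OF that] \<eta> p_1 p_m1 by auto
  have step: "\<exists>X'\<subseteq>X. \<exists>Y'\<subseteq>Y. (\<Sum>z\<in>X\<times>Y. f z * c z * p (f z)) \<le> (\<Sum>z\<in>X'\<times>Y'. f z * c z)"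
    if "\<And>z. c z \<ge> 0" for c
    using sign_matrix_rectangle_step[OF fin ne f r that] by (simp add: p_def)
  obtain X' Y' where XY: "X' \<subseteq> X" "Y' \<subseteq> Y"
    and gain: "(\<Sum>z\<in>X\<times>Y. f z * c z * p (f z) ^ k) \<le> (\<Sum>z\<in>X'\<times>Y'. f z * c z)"
    using rectangle_amplification[where f = f and p = p and c = c and k = k, OF fin p_nonneg step c]
    by blast
  define pos where "pos = (\<lambda>A. \<Sum>z\<in>A. if f z = 1 then pmf \<mu> z else 0)"
  define neg where "neg = (\<lambda>A. \<Sum>z\<in>A. if f z = 1 then 0 else pmf \<mu> z)"
  have nonneg: "pos A \<ge> 0" "neg A \<ge> 0" for A
    unfolding pos_def neg_def by (auto intro: sum_nonneg)
  \<comment> \<open>Stated for general \<open>w\<close>: it is used with the powers of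
    \<open>p\<close> on all of \<open>X \<times> Y\<close> and with the constant 1 on
    \<open>R\<close>.\<close>
  have split: "(\<Sum>z\<in>A. f z * c z * w (f z)) = w 1 * pos A - w (-1) * (2 / \<delta>) * neg A"
    if "A \<subseteq> X \<times> Y" for A and w :: "real \<Rightarrow> real"
    unfolding pos_def neg_def sum_distrib_left sum_subtractf[symmetric]
  proof (intro sum.cong refl)
    fix z assume "z \<in> A"
    then have "f z = 1 \<or> f z = -1"
      using f_cases that by blast
    then show "f z * c z * w (f z) = w 1 * (if f z = 1 then pmf \<mu> z else 0)
        - w (-1) * (2 / \<delta>) * (if f z = 1 then 0 else pmf \<mu> z)"
      by (auto simp: c_def)
  qed
  have signed: "(\<Sum>z\<in>A. f z * pmf \<mu> z) = pos A - neg A" if "A \<subseteq> X \<times> Y" for A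
    unfolding pos_def neg_def sum_subtractf[symmetric]
  proof (intro sum.cong refl)
    fix z assume "z \<in> A"
    then have "f z = 1 \<or> f z = -1"
      using f_cases that by blast
    then show "f z * pmf \<mu> z = (if f z = 1 then pmf \<mu> z else 0) - (if f z = 1 then 0 else pmf \<mu> z)"
      by auto
  qed
  have prob: "measure_pmf.prob \<mu> A = pos A + neg A" if "finite A" for A
    using that unfolding pos_def neg_def sum.distrib[symmetric]
    by (simp add: measure_measure_pmf_finite) (rule sum.cong, auto)
  define R where "R = X' \<times> Y'"
  have R: "R \<subseteq> X \<times> Y" "finite R"
    using XY fin by (auto simp: R_def intro: finite_subset)
  have pos_all: "pos (X \<times> Y) \<ge> \<delta>"
  proof -
    have "pos (X \<times> Y) = measure_pmf.prob \<mu> {z \<in> X \<times> Y. f z = 1}"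
      using fin by (simp add: pos_def measure_measure_pmf_finite sum.inter_filter)
    then show ?thesis using mass by simp
  qed
  have neg_all: "neg (X \<times> Y) \<le> 1"
    using prob[of "X \<times> Y"] fin nonneg(1)[of "X \<times> Y"] measure_pmf.prob_le_1[of \<mu> "X \<times> Y"] by simp
  \<comment> \<open>The entries 1 contribute at least \<open>\<delta>\<close>, the charged entries
    -1 at most \<open>\<delta> / 2\<close>, both in units of \<open>p 1 ^ k\<close>.\<close>
  have "p 1 ^ k * (\<delta> / 2) = p 1 ^ k * \<delta> - (p 1 ^ k * (\<delta>\<^sup>2 / 4)) * (2 / \<delta>) * 1"
    using \<delta> by (simp add: field_simps power2_eq_square)
  also have "\<dots> \<le> p 1 ^ k * pos (X \<times> Y) - p (-1) ^ k * (2 / \<delta>) * neg (X \<times> Y)"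
    using pk pos_all neg_all \<delta> \<eta> nonneg
    by (intro diff_mono mult_mono mult_nonneg_nonneg) (auto simp: p_1 p_m1)
  also have "\<dots> = (\<Sum>z\<in>X\<times>Y. f z * c z * p (f z) ^ k)"
    using split[of "X \<times> Y" "\<lambda>t. p t ^ k"] by simp
  also note gain
  also have "(\<Sum>z\<in>X'\<times>Y'. f z * c z) = pos R - (2 / \<delta>) * neg R"
    using split[OF R(1), of "\<lambda>_. 1"] by (simp add: R_def)
  finally have gain_R: "p 1 ^ k * (\<delta> / 2) \<le> pos R - (2 / \<delta>) * neg R" .
  have p1k_\<delta>: "\<delta> / 2 * (1 / 4) ^ k \<le> p 1 ^ k * (\<delta> / 2)"
    using p1k \<delta> by simp
  have neg_R: "(2 / \<delta>) * neg R \<ge> 0"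
    using nonneg \<delta> by simp
  have mass_R: "measure_pmf.prob \<mu> R \<ge> \<delta> / 2 * (1 / 4) ^ k"
    using gain_R p1k_\<delta> neg_R prob[OF R(2)] nonneg(2)[of R] by linarith
  have q: "0 < \<delta> / 2 * (1 / 4) ^ k"
    using \<delta> by simp
  have prob_R: "measure_pmf.prob \<mu> R > 0"
    using mass_R q by linarith
  have "measure_pmf.expectation (cond_pmf \<mu> R) f = (pos R - neg R) / (pos R + neg R)"
    unfolding expectation_cond_pmf_finite[OF R(2) prob_R] signed[OF R(1)] prob[OF R(2)] ..
  moreover have "(1 - \<delta>) * (pos R + neg R) \<le> pos R - neg R"
  proof -
    have "(2 / \<delta>) * neg R \<le> pos R"
      using gain_R p1k_\<delta> q by linarith
    then have "2 * neg R \<le> \<delta> * pos R"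
      using \<delta> by (simp add: field_simps)
    moreover have "0 \<le> \<delta> * neg R"
      using nonneg \<delta> by simp
    ultimately show ?thesis
      by (simp add: algebra_simps)
  qed
  ultimately have "measure_pmf.expectation (cond_pmf \<mu> R) f \<ge> 1 - \<delta>"
    using prob_R prob[OF R(2)] by (simp add: le_divide_eq)
  then show ?thesis
    using XY mass_R r_pos by (auto simp: R_def)
qed

text \<open>For \<open>\<delta> \<ge> 2 / 3\<close>, where
  \<open>2 * \<delta> - 1 \<ge> 1 - \<delta>\<close>, this makes the full rectangle good
  enough.\<close>

lemma expectation_sign_ge:
  fixes f :: "'a \<times> 'b \<Rightarrow> real" and \<mu> :: "('a \<times> 'b) pmf"
  assumes fin: "finite X" "finite Y" and f: "f \<in> X \<times> Y \<rightarrow> {-1, 1}"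
    and supp: "set_pmf \<mu> \<subseteq> X \<times> Y"
    and mass: "measure_pmf.prob \<mu> {z \<in> X \<times> Y. f z = 1} \<ge> \<delta>"
  shows "measure_pmf.prob \<mu> (X \<times> Y) = 1"
    "measure_pmf.expectation (cond_pmf \<mu> (X \<times> Y)) f \<ge> 2 * \<delta> - 1"
proof -
  show prob: "measure_pmf.prob \<mu> (X \<times> Y) = 1"
    using supp by (subst measure_pmf.prob_eq_1) (auto simp: AE_measure_pmf_iff)
  have "measure_pmf.prob \<mu> (X \<times> Y) = (\<Sum>z\<in>X\<times>Y. pmf \<mu> z)"
    using fin by (simp add: measure_measure_pmf_finite)
  moreover have "measure_pmf.prob \<mu> {z \<in> X \<times> Y. f z = 1} = (\<Sum>z\<in>X\<times>Y. if f z = 1 then pmf \<mu> z else 0)"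
    using fin by (simp add: measure_measure_pmf_finite sum.inter_filter)
  moreover have "(\<Sum>z\<in>X\<times>Y. f z * pmf \<mu> z)
      = 2 * (\<Sum>z\<in>X\<times>Y. if f z = 1 then pmf \<mu> z else 0) - (\<Sum>z\<in>X\<times>Y. pmf \<mu> z)"
    unfolding sum_distrib_left sum_subtractf[symmetric]
  proof (intro sum.cong refl)
    fix z assume "z \<in> X \<times> Y"
    then have "f z = -1 \<or> f z = 1"
      using f by blast
    then show "f z * pmf \<mu> z = 2 * (if f z = 1 then pmf \<mu> z else 0) - pmf \<mu> z"
      by auto
  qed
  ultimately show "measure_pmf.expectation (cond_pmf \<mu> (X \<times> Y)) f \<ge> 2 * \<delta> - 1"
    using mass prob fin by (subst expectation_cond_pmf_finite) auto
qed

text \<open>Near \<open>\<delta> = 1\<close> the exponent tends to 0 and leaves no room for the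
  additive losses, hence the case split. Below 2/3 the logarithm \<open>l\<close> is at least 1/2,
  so constants are absorbed into multiples of \<open>l\<close>.\<close>

lemma rectangle_bound_67: "rectangle_bound TYPE('a) TYPE('b) 67"
  unfolding rectangle_bound_def
proof (intro allI impI)
  fix X :: "'a set" and Y :: "'b set" and f :: "'a \<times> 'b \<Rightarrow> real" and r :: nat
    and \<mu> :: "('a \<times> 'b) pmf" and \<delta> :: real
  assume fin: "finite X" "finite Y" and f: "f \<in> X \<times> Y \<rightarrow> {-1, 1}"
    and rank: "matrix_rank X Y (\<lambda>x y. f (x, y)) = r"
    and supp: "set_pmf \<mu> \<subseteq> X \<times> Y"
    and \<delta>: "\<delta> > 0" and mass: "measure_pmf.prob \<mu> {z \<in> X \<times> Y. f z = 1} \<ge> \<delta>"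
  define l where "l = log 2 (1 / \<delta>)"
  have "\<delta> \<le> 1"
    using mass measure_pmf.prob_le_1 order_trans by blast
  then have l_nonneg: "l \<ge> 0"
    using \<delta> by (simp add: l_def)
  show "\<exists>X' Y'. X' \<subseteq> X \<and> Y' \<subseteq> Y \<and>
    measure_pmf.prob \<mu> (X' \<times> Y') \<ge> 2 powr (- (67 * (sqrt (real r) * log 2 (1 / \<delta>)))) \<and>
    measure_pmf.expectation (cond_pmf \<mu> (X' \<times> Y')) f \<ge> 1 - \<delta>"
  proof (cases "\<delta> \<ge> 2 / 3")
    case True
    have "2 powr (- (67 * (sqrt (real r) * l))) \<le> 2 powr 0"
      using l_nonneg by (intro powr_mono) auto
    then show ?thesis
      using expectation_sign_ge[OF fin f supp mass] True
      by (intro exI[of _ X] exI[of _ Y]) (auto simp: l_def)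
  next
    case False
    have "2 powr (1 / 2) \<le> 1 / \<delta>"
    proof -
      have "sqrt 2 \<le> 3 / 2"
        by (rule real_le_lsqrt) (auto simp: power2_eq_square)
      also have "\<dots> \<le> 1 / \<delta>"
        using \<delta> False by (simp add: field_simps)
      finally show ?thesis by (simp add: powr_half_sqrt)
    qed
    then have l_half: "l \<ge> 1 / 2"
      unfolding l_def using \<delta> by (subst le_log_iff) auto
    have log_2\<delta>: "log 2 (2 / \<delta>) = 1 + l"
      using \<delta> log_mult[of 2 "1 / \<delta>" 2] by (simp add: l_def)
    have ln_le: "ln (2 / \<delta>) \<le> 1 + l"
    proof -
      have "ln (2 / \<delta>) \<ge> 0"
        using \<delta> \<open>\<delta> \<le> 1\<close> by simp
      then have "ln (2 / \<delta>) * ln 2 \<le> ln (2 / \<delta>) * 1"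
        using ln_2_less_1 by (intro mult_left_mono) auto
      then have "ln (2 / \<delta>) \<le> ln (2 / \<delta>) / ln 2"
        by (simp add: le_divide_eq)
      then show ?thesis
        using log_2\<delta> by (simp add: log_def)
    qed
    define k where "k = nat \<lceil>10 * sqrt r * ln (2 / \<delta>)\<rceil>"
    have k: "real k \<ge> 10 * sqrt r * ln (2 / \<delta>)"
      unfolding k_def by (rule real_nat_ceiling_ge)
    obtain X' Y' where r: "r > 0" and XY: "X' \<subseteq> X" "Y' \<subseteq> Y"
      "measure_pmf.prob \<mu> (X' \<times> Y') \<ge> \<delta> / 2 * (1 / 4) ^ k"
      "measure_pmf.expectation (cond_pmf \<mu> (X' \<times> Y')) f \<ge> 1 - \<delta>"
      using biased_rectangle_exists[OF fin f rank[symmetric] supp \<delta> mass k] by blast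
    have s: "sqrt r \<ge> 1"
      using r by simp
    then have sl: "sqrt r * l \<ge> l"
      using l_nonneg mult_right_mono[of 1 "sqrt r" l] by simp
    have "10 * sqrt r * ln (2 / \<delta>) \<ge> 0"
      using \<delta> \<open>\<delta> \<le> 1\<close> by simp
    \<comment> \<open>With \<open>1 \<le> 2 * l\<close> and \<open>l \<le> sqrt r * l\<close>,
      \<open>k\<close> is at most 30 + 2 multiples of \<open>sqrt r * l\<close>. The mass
      \<open>\<delta> / 2 * (1 / 4) ^ k\<close> is 2 to the power \<open>- (1 + l + 2 * k)\<close>,
      which costs 2 + 1 + 64 = 67 multiples.\<close>
    then have "real k \<le> 10 * sqrt r * ln (2 / \<delta>) + 1"
      unfolding k_def by linarith
    also have "\<dots> \<le> 10 * sqrt r * (3 * l) + 1"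
      using ln_le l_half s by (intro add_right_mono mult_left_mono) auto
    also have "10 * sqrt r * (3 * l) = 30 * (sqrt r * l)"
      by simp
    also have "30 * (sqrt r * l) + 1 \<le> 32 * (sqrt r * l)"
      using sl l_half by linarith
    finally have "1 + l + 2 * real k \<le> 67 * (sqrt r * l)"
      using sl l_half by linarith
    then have "2 powr (- (67 * (sqrt r * l))) \<le> 2 powr (- (1 + l + 2 * real k))"
      by (intro powr_mono) auto
    also have "\<dots> = 2 powr (- log 2 (2 / \<delta>)) * (2 powr - 2) powr real k"
      by (simp add: log_2\<delta> powr_powr flip: powr_add)
    also have "2 powr (- log 2 (2 / \<delta>)) = \<delta> / 2"
      using \<delta> by (simp add: powr_minus)
    also have "(2 powr - 2) powr real k = (1 / 4 :: real) ^ k"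
      by (simp add: powr_minus powr_realpow)
    finally show ?thesis
      using XY by (intro exI[of _ X'] exI[of _ Y']) (auto simp: l_def)
  qed
qed

section \<open>Relabelling and change of types\<close>

text \<open>Relabelling the rows is a linear map \<open>T\<close> that takes columns to columns, so
  the image of a basis spans the new columns.\<close>

lemma matrix_rank_relabel_le:
  fixes h :: "'a \<Rightarrow> 'c" and k :: "'b \<Rightarrow> 'd"
  assumes fin: "finite Y" and inj: "inj_on h X" "inj_on k Y"
  shows "matrix_rank (h ` X) (k ` Y) (\<lambda>m n. M (inv_into X h m) (inv_into Y k n)) \<le> matrix_rank X Y M"
proof -
  define col where "col = (\<lambda>y x. if x \<in> X then M x y else 0)"
  define T where "T = (\<lambda>(g :: 'a \<Rightarrow> real) m. if m \<in> h ` X then g (inv_into X h m) else 0)"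
  obtain S where S: "S \<subseteq> col ` Y" "col ` Y \<subseteq> fun_vs.span S" "card S = fun_vs.dim (col ` Y)"
    using fun_vs.basis_exists[of "col ` Y"] by metis
  have S_fin: "finite S"
    using S(1) fin by (meson finite_imageI finite_subset)
  have T_span: "T g \<in> fun_vs.span (T ` S)" if "g \<in> fun_vs.span S" for g
    using that
  proof (induction rule: fun_vs.span_induct_alt)
    case base
    have "T 0 = 0" by (auto simp: T_def fun_eq_iff)
    then show ?case using fun_vs.span_zero by metis
  next
    case (step c g h)
    have "T ((\<lambda>x. c * g x) + h) = (\<lambda>m. c * T g m) + T h"
      by (auto simp: T_def fun_eq_iff)
    moreover have "(\<lambda>m. c * T g m) + T h \<in> fun_vs.span (T ` S)"
      using step by (intro fun_vs.span_add fun_vs.span_scale fun_vs.span_base[of "T g"]) auto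
    ultimately show ?case by (simp only:)
  qed
  have col_eq: "(\<lambda>n m. if m \<in> h ` X then M (inv_into X h m) (inv_into Y k n) else 0) (k y) = T (col y)"
    if "y \<in> Y" for y
    using that inj by (auto simp: T_def col_def fun_eq_iff)
  have "(\<lambda>n m. if m \<in> h ` X then M (inv_into X h m) (inv_into Y k n) else 0) ` (k ` Y) = T ` col ` Y"
    unfolding image_image using col_eq by (intro image_cong) auto
  also have "\<dots> \<subseteq> fun_vs.span (T ` S)"
    using S(2) T_span by blast
  finally have "matrix_rank (h ` X) (k ` Y) (\<lambda>m n. M (inv_into X h m) (inv_into Y k n)) \<le> card (T ` S)"
    unfolding matrix_rank_def using S_fin by (intro fun_vs.dim_le_card) auto
  also have "\<dots> \<le> card S"
    using S_fin by (rule card_image_le)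
  finally show ?thesis
    by (simp add: S(3) matrix_rank_def col_def)
qed

lemma cond_pmf_cong:
  assumes "set_pmf p \<inter> A = set_pmf p \<inter> B" "set_pmf p \<inter> A \<noteq> {}"
  shows "cond_pmf p A = cond_pmf p B"
proof (rule pmf_eqI)
  fix x
  have "measure_pmf.prob p A = measure_pmf.prob p B"
    using measure_Int_set_pmf[of p A] measure_Int_set_pmf[of p B] assms(1)
    by (simp add: Int_commute)
  moreover have "set_pmf p \<inter> B \<noteq> {}"
    using assms by simp
  moreover have "x \<in> A \<longleftrightarrow> x \<in> B" if "x \<in> set_pmf p"
    using assms(1) that by blast
  ultimately show "pmf (cond_pmf p A) x = pmf (cond_pmf p B) x"
    using assms(2) by (cases "x \<in> set_pmf p") (simp_all add: pmf_cond pmf_eq_0_set_pmf)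
qed

text \<open>Keeps the given \<open>C\<close>: embed \<open>X\<close> and \<open>Y\<close> into the
  natural numbers, push \<open>\<mu>\<close> forward, and pull the rectangle back.\<close>

lemma rectangle_bound_transfer:
  assumes bound: "rectangle_bound TYPE(nat) TYPE(nat) C" and C: "C > 0"
  shows "rectangle_bound TYPE('a) TYPE('b) C"
  unfolding rectangle_bound_def
proof (intro allI impI)
  fix X :: "'a set" and Y :: "'b set" and f :: "'a \<times> 'b \<Rightarrow> real" and r :: nat
    and \<mu> :: "('a \<times> 'b) pmf" and \<delta> :: real
  assume fin: "finite X" "finite Y" and f: "f \<in> X \<times> Y \<rightarrow> {-1, 1}"
    and rank: "matrix_rank X Y (\<lambda>x y. f (x, y)) = r"
    and supp: "set_pmf \<mu> \<subseteq> X \<times> Y"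
    and \<delta>: "\<delta> > 0" and mass: "measure_pmf.prob \<mu> {z \<in> X \<times> Y. f z = 1} \<ge> \<delta>"
  obtain h :: "'a \<Rightarrow> nat" where h: "inj_on h X"
    using finite_imp_inj_to_nat_seg[OF fin(1)] by blast
  obtain k :: "'b \<Rightarrow> nat" where k: "inj_on k Y"
    using finite_imp_inj_to_nat_seg[OF fin(2)] by blast
  define e where "e = map_prod h k"
  define f' where "f' = (\<lambda>(m, n). f (inv_into X h m, inv_into Y k n))"
  define r' where "r' = matrix_rank (h ` X) (k ` Y) (\<lambda>m n. f' (m, n))"
  have f'_e: "f' (e z) = f z" if "z \<in> X \<times> Y" for z
    using that h k by (auto simp: f'_def e_def)
  have "r' \<le> r"
    unfolding r'_def rank[symmetric] f'_def
    using matrix_rank_relabel_le[OF fin(2) h k, of "\<lambda>x y. f (x, y)"] by simp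
  have f'_sign: "f' \<in> h ` X \<times> k ` Y \<rightarrow> {-1, 1}"
    using f h k by (auto simp: f'_def Pi_iff)
  have supp': "set_pmf (map_pmf e \<mu>) \<subseteq> h ` X \<times> k ` Y"
    using supp by (auto simp: e_def)
  have mass_e: "\<delta> \<le> measure_pmf.prob (map_pmf e \<mu>) {z \<in> h ` X \<times> k ` Y. f' z = 1}"
  proof -
    have "{z \<in> X \<times> Y. f z = 1} \<subseteq> e -` {z \<in> h ` X \<times> k ` Y. f' z = 1}"
      using f'_e by (auto simp: e_def)
    then have "measure_pmf.prob \<mu> {z \<in> X \<times> Y. f z = 1}
        \<le> measure_pmf.prob \<mu> (e -` {z \<in> h ` X \<times> k ` Y. f' z = 1})"
      by (intro measure_pmf.finite_measure_mono) auto
    then show ?thesis using mass by simp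
  qed
  have "\<exists>A B. A \<subseteq> h ` X \<and> B \<subseteq> k ` Y \<and>
      2 powr (- (C * (sqrt r' * log 2 (1 / \<delta>)))) \<le> measure_pmf.prob (map_pmf e \<mu>) (A \<times> B) \<and>
      1 - \<delta> \<le> measure_pmf.expectation (cond_pmf (map_pmf e \<mu>) (A \<times> B)) f'"
    using fin by (intro bound[unfolded rectangle_bound_def, rule_format] f'_sign supp' mass_e \<delta>)
      (auto simp: r'_def)
  then obtain A B where
    mass': "2 powr (- (C * (sqrt r' * log 2 (1 / \<delta>)))) \<le> measure_pmf.prob (map_pmf e \<mu>) (A \<times> B)"
    and exp': "1 - \<delta> \<le> measure_pmf.expectation (cond_pmf (map_pmf e \<mu>) (A \<times> B)) f'"
    by blast
  define X' where "X' = {x \<in> X. h x \<in> A}"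
  define Y' where "Y' = {y \<in> Y. k y \<in> B}"
  \<comment> \<open>The preimage of \<open>A \<times> B\<close> may contain points outside
    \<open>X \<times> Y\<close>, but none of them carry mass.\<close>
  have Int: "set_pmf \<mu> \<inter> e -` (A \<times> B) = set_pmf \<mu> \<inter> X' \<times> Y'"
    using supp by (auto simp: X'_def Y'_def e_def)
  have prob_eq: "measure_pmf.prob (map_pmf e \<mu>) (A \<times> B) = measure_pmf.prob \<mu> (X' \<times> Y')"
    using measure_Int_set_pmf[of \<mu> "e -` (A \<times> B)"] measure_Int_set_pmf[of \<mu> "X' \<times> Y'"] Int
    by (simp add: Int_commute)
  \<comment> \<open>The lower bound is a power of 2, hence positive, so conditioning on the
    rectangle is meaningful.\<close>
  have "measure_pmf.prob \<mu> (X' \<times> Y') > 0"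
    by (rule less_le_trans[OF _ mass'[unfolded prob_eq]]) simp
  then have ne: "set_pmf \<mu> \<inter> X' \<times> Y' \<noteq> {}"
    using measure_Int_set_pmf[of \<mu> "X' \<times> Y'"] by (force simp: Int_commute)
  have "cond_pmf (map_pmf e \<mu>) (A \<times> B) = map_pmf e (cond_pmf \<mu> (X' \<times> Y'))"
    using ne Int by (simp add: cond_map_pmf cond_pmf_cong[OF Int])
  then have "measure_pmf.expectation (cond_pmf (map_pmf e \<mu>) (A \<times> B)) f'
      = measure_pmf.expectation (cond_pmf \<mu> (X' \<times> Y')) (\<lambda>z. f' (e z))"
    by simp
  also have "\<dots> = measure_pmf.expectation (cond_pmf \<mu> (X' \<times> Y')) f"
    using ne supp f'_e by (intro integral_cong_AE) (auto simp: AE_measure_pmf_iff)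
  finally have "1 - \<delta> \<le> measure_pmf.expectation (cond_pmf \<mu> (X' \<times> Y')) f"
    using exp' by simp
  moreover have "2 powr (- (C * (sqrt r * log 2 (1 / \<delta>)))) \<le> measure_pmf.prob \<mu> (X' \<times> Y')"
  proof -
    \<comment> \<open>This makes the logarithm nonnegative, so passing from \<open>r'\<close> to the
      larger \<open>r\<close> only weakens the bound on the mass.\<close>
    have "\<delta> \<le> 1"
      using mass measure_pmf.prob_le_1 order_trans by blast
    then have "C * (sqrt r' * log 2 (1 / \<delta>)) \<le> C * (sqrt r * log 2 (1 / \<delta>))"
      using C \<delta> \<open>r' \<le> r\<close> by (intro mult_left_mono mult_right_mono) auto
    then have "2 powr (- (C * (sqrt r * log 2 (1 / \<delta>)))) \<le> 2 powr (- (C * (sqrt r' * log 2 (1 / \<delta>))))"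
      by (intro powr_mono) auto
    then show ?thesis
      using mass'[unfolded prob_eq] by (rule order_trans)
  qed
  ultimately show "\<exists>X' Y'. X' \<subseteq> X \<and> Y' \<subseteq> Y \<and>
    measure_pmf.prob \<mu> (X' \<times> Y') \<ge> 2 powr (- (C * (sqrt (real r) * log 2 (1 / \<delta>)))) \<and>
    measure_pmf.expectation (cond_pmf \<mu> (X' \<times> Y')) f \<ge> 1 - \<delta>"
    by (intro exI[of _ X'] exI[of _ Y']) (auto simp: X'_def Y'_def)
qed

(* One absolute constant C serves finite sets X, Y of arbitrary types. HOL cannot quantify over
   types below "EX C", so: some C > 0 works over nat, and every C that works over nat works over
   all types 'a, 'b. *)
theorem theorem2:
  shows "(\<exists>C>0. rectangle_bound TYPE(nat) TYPE(nat) C) \<and>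
         (\<forall>C>0. rectangle_bound TYPE(nat) TYPE(nat) C \<longrightarrow> rectangle_bound TYPE('a) TYPE('b) C)"
proof (intro conjI exI allI impI)
  show "(67::real) > 0" by simp
qed (fact rectangle_bound_67, rule rectangle_bound_transfer)

end
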